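(* For every integer $N\ge 0$ and every $s\in\mathbb{Z}$, $$\sum_{\substack{\pi\in\Lambda^{2,2}\\ \mathrm{lrg}(\pi)\le N\\ \omega^{2,2}(\pi)=s}} q^{|\pi|} = q^{s(s-1)}\,\mathrm{T}_0\!\left(N,\; s-N+2\lfloor \tfrac{N}{2}\rfloor;\, q\right),$$ and $$\sum_{\substack{\pi\in\Lambda^{1,2}\\ \mathrm{lrg}(\pi)\le N\\ \omega^{1,2}(\pi)=s}} q^{|\pi|} = q^{s^2}\left[\mathrm{T}_1(N,s;q)+q^{N-(-1)^N s+1}\,\mathrm{T}_0\!\left(N,\,s-(-1)^N;\,q\right)\right].$$
   Context: Here $q$ is an indeterminate. Partitions. A partition $\lambda=(\lambda_1,\lambda_2,\ldots,\lambda_l)$ is a finite (possibly empty) sequence of positive integers $\lambda_1\ge\lambda_2\ge\cdots\ge\lambda_l$, called its parts; its size is $|\lambda|=\lambda_1+\cdots+\lambda_l$, its length is $\mathrm{len}(\lambda)=l$, and $\mathrm{lrg}(\lambda)$ denotes its largest part. For the empty partition, $|\lambda|=\mathrm{len}(\lambda)=\mathrm{lrg}(\lambda)=0$. A partition is strict if its parts are pairwise distinct. 2-residue difference. The Young diagram of $\lambda$ has boxes $(i,j)$ with $1\le i\le l$ and $1\le j\le\lambda_i$. The 2-residue of the box $(i,j)$ is $(i-j)\bmod 2\in\{0,1\}$. Define $$\omega(\lambda)=\#\{\text{boxes of } \lambda \text{ with 2-residue } 0\}-\#\{\text{boxes of } \lambda\text{ with 2-residue }1\}.$$ Kleshchev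 bipartitions. For $a\in\{1,2\}$ and $i\in\{1,2\}$, put $t_i=0$ if $1\le i\le a$ and $t_i=1$ if $a+1\le i\le 2$. The set $\Lambda^{a,2}$ consists of all pairs $\pi=(\pi^{(1)},\pi^{(2)})$ of strict partitions such that $\mathrm{lrg}(\pi^{(1)})+t_1\le \mathrm{len}(\pi^{(2)})+t_2$. (So $\Lambda^{2,2}$ is given by $\mathrm{lrg}(\pi^{(1)})\le\mathrm{len}(\pi^{(2)})$ and $\Lambda^{1,2}$ by $\mathrm{lrg}(\pi^{(1)})\le\mathrm{len}(\pi^{(2)})+1$.) For $\pi\in\Lambda^{a,2}$ put $|\pi|=|\pi^{(1)}|+|\pi^{(2)}|$, $\mathrm{lrg}(\pi)=\mathrm{lrg}(\pi^{(2)})$, and $$\omega^{a,2}(\pi)=(-1)^{t_1}\omega(\pi^{(1)})+(-1)^{t_2}\omega(\pi^{(2)}).$$ (So $\omega^{2,2}(\pi)=\omega(\pi^{(1)})+\omega(\pi^{(2)})$ and $\omega^{1,2}(\pi)=\omega(\pi^{(1)})-\omega(\pi^{(2)})$.) $q$-binomials and $q$-trinomials. Let $(a;q)_\infty=\prod_{k\ge0}(1-aq^k)$ and $(a;q)_n=(a;q)_\infty/(aq^n;q)_\infty$ for $n\in\mathbb{Z}$. For integers $M,N$ the $q$-binomial coefficient is $${N\brack M}_q=\frac{(q^{N-M+1};q)_M}{(q;q)_M},$$ which equals $0$ if $N\ge 0$ and ($M<0$ or $M>N$); ${N\brack M}_{q^2}$ is obtained by replacing $q$ by $q^2$. For integers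 $L\ge0$ and $A$, $$\mathrm{T}_0(L,A;q)=\sum_{l=0}^L(-1)^l{L\brack l}_{q^2}{2L-2l\brack L-A-l}_q,\qquad \mathrm{T}_1(L,A;q)=\sum_{l=0}^L(-q)^l{L\brack l}_{q^2}{2L-2l\brack L-A-l}_q.$$ *)

theory Defs
  imports "HOL-Analysis.Infinite_Products" "HOL-Computational_Algebra.Formal_Laurent_Series"
begin

section \<open>Partitions\<close>

definition partition :: "nat list \<Rightarrow> bool" where
  "partition p \<longleftrightarrow> sorted_wrt (\<ge>) p \<and> (\<forall>x\<in>set p. x > 0)"

definition strict_partition :: "nat list \<Rightarrow> bool" where
  "strict_partition p \<longleftrightarrow> partition p \<and> distinct p"

definition lrg :: "nat list \<Rightarrow> nat" where
  "lrg p = Max (insert 0 (set p))"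

text \<open>Boxes are numbered from 1, while lists are indexed from 0.\<close>

definition young_diagram :: "nat list \<Rightarrow> (nat \<times> nat) set" where
  "young_diagram p = {(i, j). 1 \<le> i \<and> i \<le> length p \<and> 1 \<le> j \<and> j \<le> p ! (i - 1)}"

definition residue2 :: "nat \<times> nat \<Rightarrow> int" where
  "residue2 b = (int (fst b) - int (snd b)) mod 2"

definition omega :: "nat list \<Rightarrow> int" where
  "omega p = int (card {b \<in> young_diagram p. residue2 b = 0})
           - int (card {b \<in> young_diagram p. residue2 b = 1})"


section \<open>Kleshchev bipartitions\<close>

text \<open>The parameter \<open>a\<close> ranges over \<open>{1, 2}\<close>.\<close>

definition tshift :: "nat \<Rightarrow> nat \<Rightarrow> nat" where
  "tshift a i = (if i \<le> a then 0 else 1)"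

definition kleshchev :: "nat \<Rightarrow> (nat list \<times> nat list) set" where
  "kleshchev a = {(p1, p2). strict_partition p1 \<and> strict_partition p2 \<and>
                            lrg p1 + tshift a 1 \<le> length p2 + tshift a 2}"

definition bisize :: "nat list \<times> nat list \<Rightarrow> nat" where
  "bisize \<pi> = sum_list (fst \<pi>) + sum_list (snd \<pi>)"

definition bilrg :: "nat list \<times> nat list \<Rightarrow> nat" where
  "bilrg \<pi> = lrg (snd \<pi>)"

definition biomega :: "nat \<Rightarrow> nat list \<times> nat list \<Rightarrow> int" where
  "biomega a \<pi> = (-1) ^ tshift a 1 * omega (fst \<pi>) + (-1) ^ tshift a 2 * omega (snd \<pi>)"


section \<open>$q$-binomials and $q$-trinomials\<close>

text \<open>
  The variable \<open>q\<close> is meant to range over formal Laurent series of positive subdegree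
  (in particular the indeterminate \<open>fls_X\<close> and its square), where the infinite products
  converge for every \<open>a\<close>; see \<open>qpoch_inf_has_prod\<close> below. The convention
  \<open>x / 0 = 0\<close> gives \<open>1 / (q; q)\<^sub>M = 0\<close> for \<open>M < 0\<close>, as intended
  (\<open>qbinom_eq_0\<close>). For a negative upper argument the quotient has a zero denominator,
  so \<open>qbinom\<close> is 0 there by convention only; \<open>T0\<close> and \<open>T1\<close> never use such arguments.
\<close>

definition qpoch_inf :: "'a :: {field, t2_space} \<Rightarrow> 'a \<Rightarrow> 'a" where
  "qpoch_inf a q = (\<Prod>k. 1 - a * q ^ k)"

definition qpoch :: "'a :: {field, t2_space} \<Rightarrow> 'a \<Rightarrow> int \<Rightarrow> 'a" where
  "qpoch a q n = qpoch_inf a q / qpoch_inf (a * q powi n) q"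

definition qbinom :: "'a :: {field, t2_space} \<Rightarrow> int \<Rightarrow> int \<Rightarrow> 'a" where
  "qbinom q N M = qpoch (q powi (N - M + 1)) q M / qpoch q q M"

definition T0 :: "nat \<Rightarrow> int \<Rightarrow> 'a :: {field, t2_space} \<Rightarrow> 'a" where
  "T0 L A q = (\<Sum>l = 0..L. (-1) ^ l * qbinom (q\<^sup>2) (int L) (int l)
                 * qbinom q (2 * int L - 2 * int l) (int L - A - int l))"

definition T1 :: "nat \<Rightarrow> int \<Rightarrow> 'a :: {field, t2_space} \<Rightarrow> 'a" where
  "T1 L A q = (\<Sum>l = 0..L. (-q) ^ l * qbinom (q\<^sup>2) (int L) (int l)
                 * qbinom q (2 * int L - 2 * int l) (int L - A - int l))"


section \<open>Well-definedness\<close>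

lemma dist_fls_mult_left:
  fixes c x y :: "'a :: field fls"
  assumes "c \<noteq> 0"
  shows "dist (c * x) (c * y) = 2 powi (- fls_subdegree c) * dist x y"
proof (cases "x = y")
  case False
  have gen: "dist u v = 2 powi (- fls_subdegree (u - v))" if "u \<noteq> v" for u v :: "'a fls"
    using that by (simp add: dist_fls_def power_int_def power_one_over inverse_eq_divide)
  have "c * x - c * y = c * (x - y)"
    by (simp add: algebra_simps)
  then have "dist (c * x) (c * y) = 2 powi (- fls_subdegree c + - fls_subdegree (x - y))"
    using False assms by (simp add: gen)
  also have "\<dots> = 2 powi (- fls_subdegree c) * 2 powi (- fls_subdegree (x - y))"
    by (rule power_int_add) simp
  finally show ?thesis
    by (simp only: gen[OF False])
qed simp

lemma tendsto_fls_mult_left: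
  fixes c L :: "'a :: field fls"
  assumes "(X \<longlongrightarrow> L) F"
  shows "((\<lambda>n. c * X n) \<longlongrightarrow> c * L) F"
proof (cases "c = 0")
  case False
  have "((\<lambda>n. dist (X n) L) \<longlongrightarrow> 0) F"
    using assms by (rule tendsto_dist_iff[THEN iffD1])
  then have "((\<lambda>n. 2 powi (- fls_subdegree c) * dist (X n) L) \<longlongrightarrow> 0) F"
    by (rule tendsto_mult_right_zero)
  then have "((\<lambda>n. dist (c * X n) (c * L)) \<longlongrightarrow> 0) F"
    using False by (simp add: dist_fls_mult_left)
  then show ?thesis
    by (rule tendsto_dist_iff[THEN iffD2])
qed simp

lemma raw_has_prod_fls_step:
  fixes f :: "nat \<Rightarrow> 'a :: field fls"
  assumes "raw_has_prod f (Suc M) p" "f M \<noteq> 0"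
  shows "raw_has_prod f M (f M * p)"
proof -
  have "(\<lambda>n. f M * (\<Prod>i\<le>n. f (i + Suc M))) \<longlonglongrightarrow> f M * p"
    using assms(1) unfolding raw_has_prod_def by (intro tendsto_fls_mult_left) auto
  moreover have "f M * (\<Prod>i\<le>n. f (i + Suc M)) = (\<Prod>i\<le>Suc n. f (i + M))" for n
    by (subst prod.atMost_Suc_shift) simp
  ultimately have "(\<lambda>n. \<Prod>i\<le>Suc n. f (i + M)) \<longlonglongrightarrow> f M * p"
    by simp
  then have "(\<lambda>n. \<Prod>i\<le>n. f (i + M)) \<longlonglongrightarrow> f M * p"
    by (rule LIMSEQ_imp_Suc)
  then show ?thesis
    using assms unfolding raw_has_prod_def by auto
qed

lemma raw_has_prod_fls_imp_has_prod:
  fixes f :: "nat \<Rightarrow> 'a :: field fls"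
  assumes "raw_has_prod f M p"
  shows "\<exists>r. f has_prod r"
  using assms
proof (induction M arbitrary: p)
  case 0
  then show ?case by (auto simp: has_prod_def)
next
  case (Suc M)
  show ?case
  proof (cases "f M = 0")
    case True
    with Suc.prems have "f has_prod 0"
      unfolding has_prod_def by blast
    then show ?thesis ..
  next
    case False
    with Suc show ?thesis
      using raw_has_prod_fls_step by blast
  qed
qed

lemma has_prod_fls_Suc:
  fixes f :: "nat \<Rightarrow> 'a :: field fls"
  assumes "(\<lambda>n. f (Suc n)) has_prod p"
  shows "f has_prod (f 0 * p)"
  using assms raw_has_prod_fls_step[of f 0 p]
  by (cases "f 0 = 0") (auto simp: has_prod_def simp flip: raw_has_prod_Suc)

lemma raw_has_prod_qpoch_fps:
  fixes a q :: "'a :: field fps"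
  assumes "fps_nth a 0 = 0" "fps_nth q 0 = 0"
  shows "\<exists>L. raw_has_prod (\<lambda>k. 1 - fps_to_fls a * fps_to_fls q ^ k) 0 L"
proof -
  define P where "P n = (\<Prod>i\<le>n. 1 - a * q ^ i)" for n
  define L where "L = Abs_fps (\<lambda>m. fps_nth (P m) m)"
  have z: "fps_nth (q ^ i * u) m = 0" if "m < i" for i m u
    using that assms(2) by (simp add: fps_mult_nth startsby_zero_power_prefix)
  have P_Suc: "fps_nth (P (Suc n)) m = fps_nth (P n) m" if "m \<le> n" for n m
  proof -
    have "P (Suc n) = P n - q ^ Suc n * (a * P n)"
      by (simp add: P_def algebra_simps)
    then show ?thesis
      using z[of m "Suc n" "a * P n"] that by simp
  qed
  have P_nth: "fps_nth (P n) m = fps_nth (P m) m" if "m \<le> n" for n m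
    using that by (induction rule: dec_induct) (auto simp: P_Suc)
  have "P \<longlonglongrightarrow> L"
  proof (rule tendsto_fpsI)
    fix m
    show "\<forall>\<^sub>F n in sequentially. fps_nth (P n) m = fps_nth L m"
      using eventually_ge_at_top[of m] unfolding L_def fps_nth_Abs_fps
      by eventually_elim (rule P_nth)
  qed
  moreover have "dist (fps_to_fls x) (fps_to_fls y) = dist x y" for x y :: "'a fps"
    by (simp add: dist_fls_def dist_fps_def fls_subdegree_fls_to_fps flip: fps_to_fls_minus)
  ultimately have "(\<lambda>n. fps_to_fls (P n)) \<longlonglongrightarrow> fps_to_fls L"
    by (subst (asm) tendsto_dist_iff, subst tendsto_dist_iff) simp
  moreover have "fps_to_fls (P n) = (\<Prod>i\<le>n. 1 - fps_to_fls a * fps_to_fls q ^ (i + 0))" for n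
    unfolding P_def by (induction n) (simp_all add: fls_times_fps_to_fls fps_to_fls_power)
  moreover have "fps_nth L 0 = 1"
    using assms by (simp add: L_def P_def)
  then have "L \<noteq> 0"
    by auto
  ultimately show ?thesis
    unfolding raw_has_prod_def by (intro exI[of _ "fps_to_fls L"]) auto
qed

lemma fls_as_fps_pos_subdegree:
  fixes f :: "'a :: field fls"
  assumes "f = 0 \<or> fls_subdegree f > 0"
  obtains g where "f = fps_to_fls g" "fps_nth g 0 = 0"
proof (rule that[of "fls_regpart f"])
  show "f = fps_to_fls (fls_regpart f)"
    using assms by (intro fls_eqI) auto
  show "fps_nth (fls_regpart f) 0 = 0"
    using assms by auto
qed

lemma qpoch_inf_has_prod:
  fixes a q :: "'a :: field fls"
  assumes q: "fls_subdegree q > 0"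
  shows "(\<lambda>k. 1 - a * q ^ k) has_prod qpoch_inf a q"
proof -
  define M where "M = nat (1 - fls_subdegree a)"
  have q0: "q \<noteq> 0"
    using q by auto
  have "fls_subdegree (a * q ^ M) > 0" if "a \<noteq> 0"
  proof -
    have "fls_subdegree (a * q ^ M) = fls_subdegree a + int M * fls_subdegree q"
      using that q0 by (simp add: fls_subdegree_pow)
    moreover have "int M * fls_subdegree q \<ge> int M * 1"
      using q by (intro mult_left_mono) auto
    ultimately show ?thesis
      by (auto simp: M_def)
  qed
  then obtain a' where a': "a * q ^ M = fps_to_fls a'" "fps_nth a' 0 = 0"
    using fls_as_fps_pos_subdegree[of "a * q ^ M"] by (metis mult_zero_left)
  obtain q' where q': "q = fps_to_fls q'" "fps_nth q' 0 = 0"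
    using fls_as_fps_pos_subdegree[of q] q by blast
  obtain L where "raw_has_prod (\<lambda>k. 1 - (a * q ^ M) * q ^ k) 0 L"
    using raw_has_prod_qpoch_fps[OF a'(2) q'(2)] unfolding a'(1)[symmetric] q'(1)[symmetric]
    by blast
  then have "raw_has_prod (\<lambda>k. 1 - a * q ^ k) M L"
    unfolding raw_has_prod_def by (simp add: power_add mult_ac)
  then obtain r where "(\<lambda>k. 1 - a * q ^ k) has_prod r"
    using raw_has_prod_fls_imp_has_prod by blast
  then show ?thesis
    using has_prod_unique[of _ r] by (simp add: qpoch_inf_def)
qed

lemma qpoch_inf_eq_0_iff:
  fixes a q :: "'a :: field fls"
  assumes "fls_subdegree q > 0"
  shows "qpoch_inf a q = 0 \<longleftrightarrow> (\<exists>k. a * q ^ k = 1)"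
  using has_prod_eq_0_iff[OF qpoch_inf_has_prod[OF assms, of a]] by (auto simp: image_iff)

lemma qpoch_inf_split:
  fixes a q :: "'a :: field fls"
  assumes "fls_subdegree q > 0"
  shows "qpoch_inf a q = (\<Prod>k<n. 1 - a * q ^ k) * qpoch_inf (a * q ^ n) q"
proof (induction n)
  case (Suc n)
  define b where "b = a * q ^ n"
  have "(\<lambda>k. 1 - b * q ^ k) has_prod ((1 - b) * qpoch_inf (b * q) q)"
    using has_prod_fls_Suc[of "\<lambda>k. 1 - b * q ^ k"] qpoch_inf_has_prod[OF assms, of "b * q"]
    by (simp only: power_Suc power_0 mult_1_right mult.assoc)
  then have "qpoch_inf b q = (1 - b) * qpoch_inf (b * q) q"
    using qpoch_inf_has_prod[OF assms, of b] has_prod_unique2 by blast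
  then show ?case
    using Suc by (simp add: b_def mult_ac)
qed simp

lemma qpoch_of_nat:
  fixes a q :: "'a :: field fls"
  assumes "fls_subdegree q > 0" "qpoch_inf (a * q ^ n) q \<noteq> 0"
  shows "qpoch a q (int n) = (\<Prod>k<n. 1 - a * q ^ k)"
  using qpoch_inf_split[OF assms(1), of a n] assms(2) by (simp add: qpoch_def)

lemma fls_power_neq_1:
  fixes q :: "'a :: field fls"
  assumes "fls_subdegree q > 0" "n > 0"
  shows "q ^ n \<noteq> 1"
proof
  assume "q ^ n = 1"
  then have "fls_subdegree (q ^ n) = 0"
    by simp
  then show False
    using assms by (simp add: fls_subdegree_pow)
qed

lemma qpoch_inf_power_neq_0:
  fixes q :: "'a :: field fls"
  assumes "fls_subdegree q > 0" "n > 0"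
  shows "qpoch_inf (q ^ n) q \<noteq> 0"
proof -
  have "q ^ n * q ^ k \<noteq> 1" for k
    using fls_power_neq_1[OF assms(1), of "n + k"] assms(2) by (simp add: power_add)
  then show ?thesis
    by (simp add: qpoch_inf_eq_0_iff[OF assms(1)])
qed

lemma qbinom_eq:
  fixes q :: "'a :: field fls"
  assumes "fls_subdegree q > 0" "m \<le> n"
  shows "qbinom q (int n) (int m) =
    (\<Prod>k<m. 1 - q ^ (n - m + 1 + k)) / (\<Prod>k<m. 1 - q ^ (k + 1))"
proof -
  have e: "int n - int m + 1 = int (n - m + 1)"
    using assms by simp
  have "qpoch (q ^ (n - m + 1)) q (int m) = (\<Prod>k<m. 1 - q ^ (n - m + 1) * q ^ k)"
    using qpoch_inf_power_neq_0[OF assms(1), of "n - m + 1 + m"] assms(1)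
    by (intro qpoch_of_nat) (simp_all add: power_add mult_ac)
  moreover have "qpoch q q (int m) = (\<Prod>k<m. 1 - q * q ^ k)"
    using qpoch_inf_power_neq_0[OF assms(1), of "Suc m"] assms(1)
    by (intro qpoch_of_nat) simp_all
  ultimately show ?thesis
    unfolding qbinom_def e power_int_of_nat by (simp add: power_add mult_ac)
qed

lemma qbinom_eq_0:
  fixes q :: "'a :: field fls"
  assumes "fls_subdegree q > 0" "N \<ge> 0" "M < 0 \<or> M > N"
  shows "qbinom q N M = 0"
proof -
  have q0: "q \<noteq> 0"
    using assms by auto
  have *: "q powi i * q ^ nat (- i) = 1" if "i \<le> 0" for i
    using that q0 by (simp add: power_int_def flip: power_mult_distrib)
  show ?thesis
  proof (cases "M < 0")
    case True
    have "q * q powi M = q powi (M + 1)"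
      using q0 by (simp add: power_int_add)
    with *[of "M + 1"] True have "q * q powi M * q ^ nat (- (M + 1)) = 1"
      by simp
    then have "qpoch_inf (q * q powi M) q = 0"
      unfolding qpoch_inf_eq_0_iff[OF assms(1)] by blast
    then show ?thesis
      by (simp add: qbinom_def qpoch_def)
  next
    case False
    with assms have "q powi (N - M + 1) * q ^ nat (- (N - M + 1)) = 1"
      by (intro *) simp
    then have "qpoch_inf (q powi (N - M + 1)) q = 0"
      unfolding qpoch_inf_eq_0_iff[OF assms(1)] by blast
    then show ?thesis
      by (simp add: qbinom_def qpoch_def)
  qed
qed

lemma finite_kleshchev_bounded: "finite {\<pi> \<in> kleshchev a. bilrg \<pi> \<le> N}"
proof -
  have le: "x \<le> lrg p" if "x \<in> set p" for x p
    using that by (simp add: lrg_def)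
  have fin: "finite {p. strict_partition p \<and> lrg p \<le> K}" for K
  proof (rule finite_subset)
    show "{p. strict_partition p \<and> lrg p \<le> K} \<subseteq> {p. set p \<subseteq> {..K} \<and> distinct p}"
      using le by (fastforce simp: strict_partition_def)
    show "finite {p. set p \<subseteq> {..K} \<and> distinct p}"
      by (rule finite_subset_distinct) simp
  qed
  have len: "length p \<le> N + 1" if "strict_partition p" "lrg p \<le> N" for p
  proof -
    have "length p = card (set p)"
      using that by (simp add: strict_partition_def distinct_card)
    also have "\<dots> \<le> card {..N}"
      using le that by (intro card_mono) fastforce+
    finally show ?thesis by simp
  qed
  have "{\<pi> \<in> kleshchev a. bilrg \<pi> \<le> N} \<subseteq>
      {p. strict_partition p \<and> lrg p \<le> N + 2} \<times> {p. strict_partition p \<and> lrg p \<le> N}"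
    using len by (fastforce simp: kleshchev_def bilrg_def tshift_def split: if_splits)
  then show ?thesis
    by (rule finite_subset) (intro finite_cartesian_product fin)
qed

end

theory Submission
  imports Defs
begin

text \<open>
  Both sides satisfy the same recurrences in \<open>N\<close>. Let \<open>F t N s\<close> be the generating function of the
  pairs of strict partitions with \<open>lrg \<pi>\<^sup>1 \<le> len \<pi>\<^sup>2 + t\<close>, \<open>lrg \<pi>\<^sup>2 \<le> N\<close> and
  \<open>\<omega>(\<pi>\<^sup>1) + (-1)\<^sup>t \<omega>(\<pi>\<^sup>2) = s\<close>; the sums in question are \<open>F 0\<close> and \<open>F 1\<close>.

  Deleting the part \<open>N\<close> from \<open>\<pi>\<^sup>2\<close> expresses \<open>F t N\<close> by \<open>F t (N - 1)\<close> and
  \<open>F (t + 1) (N - 1)\<close> (\<open>bigf_Suc\<close>). This recurrence raises \<open>t\<close>, but it closes up at \<open>t = 2\<close> because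
  of the identity \<open>F 2 N s = F 0 N s + q F 0 (N + 1) (1 - s)\<close> (\<open>bigf_2\<close>). It has a bijective
  proof: if the largest part \<open>m\<close> of \<open>\<pi>\<^sup>1\<close> is \<open>len \<pi>\<^sup>2 + 1\<close> or \<open>len \<pi>\<^sup>2 + 2\<close>, then that part is
  removed and a column of height \<open>m - 1\<close> is put in front of the diagram of \<open>\<pi>\<^sup>2\<close>. Hence \<open>F 0\<close> and
  \<open>F 1\<close> are determined by a first order system of recurrences.

  On the other side, \<open>T0\<close> and \<open>T1\<close> are even functions of \<open>A\<close> and satisfy
  \<open>T1(L, A) = T1(L-1, A) + q\<^bsup>L+A\<^esup> T0(L-1, A+1) + q\<^bsup>L-A\<^esup> T0(L-1, A-1)\<close> and
  \<open>T0(L, A) = T0(L-1, A-1) + q\<^bsup>L+A\<^esup> T1(L-1, A) + q\<^bsup>2L+2A\<^esup> T0(L-1, A+1)\<close>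
  (\<open>T1_rec\<close>, \<open>T0_rec\<close>), which follow from the two Pascal rules for the $q$-binomial coefficients.
  With these, the claimed closed forms are verified by induction on \<open>N\<close>.
\<close>


section \<open>Recurrences for the $q$-binomial coefficients\<close>

context
  fixes q :: "'a :: field fls"
  assumes q: "fls_subdegree q > 0"
begin

lemma q_nonzero: "q \<noteq> 0"
  using q by auto

lemma qpoch_inf_powi_rec:
  "qpoch_inf (q powi j) q = (1 - q powi j) * qpoch_inf (q powi (j + 1)) q"
  using qpoch_inf_split[OF q, of "q powi j" 1] q_nonzero by (simp add: power_int_add)

lemma qpoch_inf_powi_nonzero: "j > 0 \<Longrightarrow> qpoch_inf (q powi j) q \<noteq> 0"
  using qpoch_inf_power_neq_0[OF q, of "nat j"] by (simp add: power_int_def)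

lemma one_minus_powi_nonzero: "j > 0 \<Longrightarrow> 1 - q powi j \<noteq> 0"
  using qpoch_inf_powi_rec[of j] qpoch_inf_powi_nonzero[of j] by auto

text \<open>
  Writing all four $q$-shifted factorials as infinite products makes the formula valid for every
  integer \<open>M\<close>: outside \<open>{0..N}\<close> one of the two factors in the numerator vanishes.
\<close>

lemma qbinom_eq_qpoch_inf:
  assumes "N \<ge> 0"
  shows "qbinom q N M =
    qpoch_inf (q powi (N - M + 1)) q * qpoch_inf (q powi (M + 1)) q /
      (qpoch_inf (q powi (N + 1)) q * qpoch_inf q q)"
proof -
  have "q powi (N - M + 1) * q powi M = q powi (N + 1)" "q * q powi M = q powi (M + 1)"
    using q_nonzero by (simp_all flip: power_int_add add: power_int_add_1')
  then show ?thesis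
    by (simp add: qbinom_def qpoch_def)
qed

lemma qbinom_sym: "N \<ge> 0 \<Longrightarrow> qbinom q N (N - M) = qbinom q N M"
  by (simp add: qbinom_eq_qpoch_inf mult.commute)

lemma qbinom_lower_rec:
  assumes "N \<ge> 0"
  shows "(1 - q powi M) * qbinom q N M = (1 - q powi (N + 1 - M)) * qbinom q N (M - 1)"
proof -
  have e: "N - M + 1 + 1 = N - (M - 1) + 1" "N - M + 1 = N + 1 - M" by simp_all
  show ?thesis
    using assms qpoch_inf_powi_rec[of M] qpoch_inf_powi_rec[of "N - M + 1"]
    by (simp add: qbinom_eq_qpoch_inf e)
qed

lemma qbinom_absorb:
  assumes "N \<ge> 0"
  shows "(1 - q powi M) * qbinom q (N + 1) M = (1 - q powi (N + 1)) * qbinom q N (M - 1)"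
proof -
  define u v where "u = q powi M" and "v = q powi (N + 1)"
  define x y z w where "x = qpoch_inf (q powi (N - (M - 1) + 1)) q"
    and "y = qpoch_inf (q powi (M + 1)) q" and "z = qpoch_inf (q powi (N + 1 + 1)) q"
    and "w = qpoch_inf q q"
  have e: "N + 1 - M + 1 = N - (M - 1) + 1" "M - 1 + 1 = M"
    by simp_all
  have M: "qpoch_inf (q powi M) q = (1 - u) * y" and N: "qpoch_inf (q powi (N + 1)) q = (1 - v) * z"
    unfolding u_def v_def y_def z_def by (rule qpoch_inf_powi_rec)+
  have nz: "z \<noteq> 0" "w \<noteq> 0" "1 - v \<noteq> 0"
    using assms qpoch_inf_powi_nonzero[of "N + 1 + 1"] qpoch_inf_powi_nonzero[of 1]
      one_minus_powi_nonzero[of "N + 1"] by (simp_all add: z_def w_def v_def)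
  have "qbinom q (N + 1) M = x * y / (z * w)"
    using assms qbinom_eq_qpoch_inf[of "N + 1" M] unfolding e x_def y_def z_def w_def by simp
  moreover have "qbinom q N (M - 1) = x * ((1 - u) * y) / ((1 - v) * z * w)"
    using assms qbinom_eq_qpoch_inf[of N "M - 1"] unfolding e M N x_def w_def by simp
  ultimately show ?thesis
    unfolding u_def[symmetric] v_def[symmetric] using nz by simp
qed

lemma qbinom_pascal1:
  assumes "N \<ge> 0"
  shows "qbinom q (N + 1) M = qbinom q N M + q powi (N + 1 - M) * qbinom q N (M - 1)"
proof -
  define a b where "a = q powi M" and "b = q powi (N + 1 - M)"
  have ab: "q powi (N + 1) = a * b"
    using q_nonzero by (simp add: a_def b_def flip: power_int_add)
  have nz: "1 - a * b \<noteq> 0"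
    using one_minus_powi_nonzero[of "N + 1"] assms by (simp add: ab)
  have 1: "(1 - a) * qbinom q N M = (1 - b) * qbinom q N (M - 1)"
    using qbinom_lower_rec[OF assms, of M] by (simp add: a_def b_def)
  have "(1 - b) * qbinom q (N + 1) M = (1 - a * b) * qbinom q N M"
    using qbinom_absorb[OF assms, of "N + 1 - M"] qbinom_sym[of "N + 1" M] qbinom_sym[of N M] assms
    by (simp add: b_def ab[symmetric, unfolded b_def])
  moreover have "(1 - a) * qbinom q (N + 1) M = (1 - a * b) * qbinom q N (M - 1)"
    using qbinom_absorb[OF assms, of M] by (simp add: ab[symmetric, unfolded a_def] a_def)
  ultimately have "(1 - a * b) * qbinom q (N + 1) M =
      (1 - a * b) * (qbinom q N M + b * qbinom q N (M - 1))"
    by algebra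
  then show ?thesis
    using nz by (simp add: b_def)
qed

lemma qbinom_pascal2:
  assumes "N \<ge> 0"
  shows "qbinom q (N + 1) M = qbinom q N (M - 1) + q powi M * qbinom q N M"
  using qbinom_pascal1[OF assms, of M] qbinom_lower_rec[OF assms, of M]
  by (simp add: algebra_simps)

end


section \<open>Recurrences for the $q$-trinomial coefficients\<close>

lemma fls_subdegree_power2_pos: "fls_subdegree q > 0 \<Longrightarrow> fls_subdegree (q\<^sup>2) > 0"
  for q :: "'a :: field fls"
  by (simp add: fls_subdegree_pow)

lemma sum_qbinom_Suc:
  fixes q :: "'a :: field fls"
  assumes q: "fls_subdegree q > 0"
  shows "(\<Sum>l = 0..Suc K. qbinom q (int (Suc K)) (int l) * f l) =
    (\<Sum>l = 0..K. qbinom q (int K) (int l) * (f l + q ^ (K - l) * f (Suc l)))"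
proof -
  let ?b = "\<lambda>i. qbinom q (int K) i"
  have "(\<Sum>l = 0..Suc K. qbinom q (int (Suc K)) (int l) * f l) =
      (\<Sum>l = 0..Suc K. ?b (int l) * f l) +
      (\<Sum>l = 0..Suc K. q powi (int K + 1 - int l) * ?b (int l - 1) * f l)"
    using qbinom_pascal1[OF q, of "int K"]
    by (simp add: algebra_simps flip: sum.distrib del: sum.atLeast0_atMost_Suc)
  also have "(\<Sum>l = 0..Suc K. ?b (int l) * f l) = (\<Sum>l = 0..K. ?b (int l) * f l)"
    using qbinom_eq_0[OF q, of "int K" "int (Suc K)"] by simp
  also have "(\<Sum>l = 0..Suc K. q powi (int K + 1 - int l) * ?b (int l - 1) * f l) =
      (\<Sum>l = 0..K. q powi (int K - int l) * ?b (int l) * f (Suc l))"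
    using qbinom_eq_0[OF q, of "int K" "-1"]
    by (subst sum.atLeast0_atMost_Suc_shift) simp
  also have "\<dots> = (\<Sum>l = 0..K. q ^ (K - l) * ?b (int l) * f (Suc l))"
    by (intro sum.cong) (auto simp: of_nat_diff simp flip: power_int_of_nat)
  finally show ?thesis
    by (simp add: algebra_simps flip: sum.distrib)
qed

text \<open>The identity behind this is \<open>(1 - q\<^bsup>l+1\<^esup>) [K; l+1] = (1 - q\<^bsup>K-l\<^esup>) [K; l]\<close>.\<close>

lemma sum_qbinom_shift:
  fixes q :: "'a :: field fls"
  assumes q: "fls_subdegree q > 0"
  shows "(\<Sum>l = 0..K. qbinom q (int K) (int l) * ((1 - q ^ l) * g l)) =
    (\<Sum>l = 0..K. qbinom q (int K) (int l) * ((1 - q ^ (K - l)) * g (Suc l)))"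
proof (cases K)
  case (Suc J)
  let ?b = "\<lambda>i. qbinom q (int K) i"
  have *: "(1 - q ^ Suc l) * ?b (int (Suc l)) = (1 - q ^ (K - l)) * ?b (int l)" if "l \<le> J" for l
  proof -
    have e: "int K + 1 - int (Suc l) = int (K - l)" "int (Suc l) - 1 = int l"
      using that Suc by simp_all
    show ?thesis
      using qbinom_lower_rec[OF q, of "int K" "int (Suc l)"]
      unfolding e power_int_of_nat by simp
  qed
  have "?b (int (Suc l)) * ((1 - q ^ Suc l) * g (Suc l)) =
      ?b (int l) * ((1 - q ^ (K - l)) * g (Suc l))" if "l \<le> J" for l
    using arg_cong[OF *[OF that], of "\<lambda>z. z * g (Suc l)"] by (simp only: mult_ac)
  then have "(\<Sum>l = 0..J. ?b (int (Suc l)) * ((1 - q ^ Suc l) * g (Suc l))) =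
      (\<Sum>l = 0..J. ?b (int l) * ((1 - q ^ (K - l)) * g (Suc l)))"
    by (intro sum.cong) auto
  moreover have "(\<Sum>l = 0..K. ?b (int l) * ((1 - q ^ l) * g l)) =
      (\<Sum>l = 0..J. ?b (int (Suc l)) * ((1 - q ^ Suc l) * g (Suc l)))"
    unfolding Suc by (subst sum.atLeast0_atMost_Suc_shift) simp
  moreover have "(\<Sum>l = 0..K. ?b (int l) * ((1 - q ^ (K - l)) * g (Suc l))) =
      (\<Sum>l = 0..J. ?b (int l) * ((1 - q ^ (K - l)) * g (Suc l)))"
    unfolding Suc by simp
  ultimately show ?thesis
    by simp
qed simp

context
  fixes q :: "'a :: field fls"
  assumes q: "fls_subdegree q > 0"
begin

lemma T0_sym: "T0 L (- A) q = T0 L A q"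
  unfolding T0_def
proof (intro sum.cong refl)
  fix l assume "l \<in> {0..L}"
  then show "(- 1) ^ l * qbinom (q\<^sup>2) (int L) (int l) *
        qbinom q (2 * int L - 2 * int l) (int L - - A - int l) =
      (- 1) ^ l * qbinom (q\<^sup>2) (int L) (int l) *
        qbinom q (2 * int L - 2 * int l) (int L - A - int l)"
    using qbinom_sym[OF q, of "2 * int L - 2 * int l" "int L - A - int l"]
    by (simp add: algebra_simps)
qed

lemma T1_sym: "T1 L (- A) q = T1 L A q"
  unfolding T1_def
proof (intro sum.cong refl)
  fix l assume "l \<in> {0..L}"
  then show "(- q) ^ l * qbinom (q\<^sup>2) (int L) (int l) *
        qbinom q (2 * int L - 2 * int l) (int L - - A - int l) =
      (- q) ^ l * qbinom (q\<^sup>2) (int L) (int l) *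
        qbinom q (2 * int L - 2 * int l) (int L - A - int l)"
    using qbinom_sym[OF q, of "2 * int L - 2 * int l" "int L - A - int l"]
    by (simp add: algebra_simps)
qed

text \<open>
  Two ways of lowering the upper index \<open>2 n + 2\<close>. The first one mixes both Pascal rules and is
  adapted to \<open>T1\<close>. The second one uses a single rule twice and is adapted to \<open>T0\<close>; it keeps a
  coefficient with upper index \<open>2 n + 1\<close>, to which \<open>sum_qbinom_shift\<close> will apply.
\<close>

lemma qbinom_double_step1:
  assumes "n \<ge> 0"
  shows "qbinom q (2 * n + 2) (m + 1) =
    q powi (m + 1) * qbinom q (2 * n) (m + 1) + q powi (2 * n + 1 - m) * qbinom q (2 * n) (m - 1)
      + (1 + q * q powi (2 * n)) * qbinom q (2 * n) m"
proof -
  have 1: "qbinom q (2 * n + 2) (m + 1) =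
      qbinom q (2 * n + 1) m + q powi (m + 1) * qbinom q (2 * n + 1) (m + 1)"
    using qbinom_pascal2[OF q, of "2 * n + 1" "m + 1"] assms by (simp add: algebra_simps)
  have 2: "qbinom q (2 * n + 1) (m + 1) =
      qbinom q (2 * n) (m + 1) + q powi (2 * n - m) * qbinom q (2 * n) m"
    using qbinom_pascal1[OF q, of "2 * n" "m + 1"] assms by (simp add: algebra_simps)
  have 3: "qbinom q (2 * n + 1) m =
      qbinom q (2 * n) m + q powi (2 * n + 1 - m) * qbinom q (2 * n) (m - 1)"
    using qbinom_pascal1[OF q, of "2 * n" m] assms by (simp add: algebra_simps)
  define a b where "a = q powi (m + 1)" and "b = q powi (2 * n - m)"
  have "q powi (m + 1 + (2 * n - m)) = a * b"
    unfolding a_def b_def using q_nonzero[OF q] by (intro power_int_add) simp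
  then have e: "q * q powi (2 * n) = a * b"
    using q_nonzero[OF q] power_int_add_1'[of q "2 * n"] by (simp add: algebra_simps)
  show ?thesis
    unfolding 1 2 3 e unfolding a_def[symmetric] b_def[symmetric]
    by (simp add: algebra_simps)
qed

lemma qbinom_double_step2:
  assumes "n \<ge> 0"
  shows "qbinom q (2 * n + 2) (m + 1) =
    qbinom q (2 * n) (m + 1) + q powi (2 * n - m) * qbinom q (2 * n) m
      + q powi (2 * n + 1 - m) * qbinom q (2 * n + 1) m"
proof -
  have 1: "qbinom q (2 * n + 2) (m + 1) =
      qbinom q (2 * n + 1) (m + 1) + q powi (2 * n + 1 - m) * qbinom q (2 * n + 1) m"
    using qbinom_pascal1[OF q, of "2 * n + 1" "m + 1"] assms by (simp add: algebra_simps)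
  have 2: "qbinom q (2 * n + 1) (m + 1) =
      qbinom q (2 * n) (m + 1) + q powi (2 * n - m) * qbinom q (2 * n) m"
    using qbinom_pascal1[OF q, of "2 * n" "m + 1"] assms by (simp add: algebra_simps)
  show ?thesis
    unfolding 1 2 by simp
qed

lemma T1_rec:
  "T1 (Suc K) A q = T1 K A q + q powi (int K + 1 + A) * T0 K (A + 1) q
    + q powi (int K + 1 - A) * T0 K (A - 1) q"
proof -
  let ?b = "\<lambda>l. qbinom (q\<^sup>2) (int K) (int l)"
  let ?f = "\<lambda>l. (- q) ^ l * qbinom q (2 * int (Suc K) - 2 * int l) (int (Suc K) - A - int l)"
  have "T1 (Suc K) A q = (\<Sum>l = 0..Suc K. qbinom (q\<^sup>2) (int (Suc K)) (int l) * ?f l)"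
    unfolding T1_def by (simp only: mult_ac)
  also have "\<dots> = (\<Sum>l = 0..K. ?b l * (?f l + (q\<^sup>2) ^ (K - l) * ?f (Suc l)))"
    by (rule sum_qbinom_Suc[OF fls_subdegree_power2_pos[OF q]])
  also have "\<dots> = (\<Sum>l = 0..K.
      (- q) ^ l * ?b l * qbinom q (2 * int K - 2 * int l) (int K - A - int l)
      + q powi (int K + 1 + A) * ((- 1) ^ l * ?b l
          * qbinom q (2 * int K - 2 * int l) (int K - (A + 1) - int l))
      + q powi (int K + 1 - A) * ((- 1) ^ l * ?b l
          * qbinom q (2 * int K - 2 * int l) (int K - (A - 1) - int l)))"
  proof (intro sum.cong refl)
    fix l assume l: "l \<in> {0..K}"
    define n m where "n = int K - int l" and "m = int K - A - int l"
    have n0: "n \<ge> 0" using l by (simp add: n_def)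
    have nn: "2 * n = int (2 * (K - l))" using l by (simp add: n_def)
    have Q: "(q\<^sup>2) ^ (K - l) = q powi (2 * n)"
      unfolding nn power_int_of_nat by (simp add: power_mult)
    have a: "2 * int (Suc K) - 2 * int l = 2 * n + 2" "int (Suc K) - A - int l = m + 1"
      "2 * int (Suc K) - 2 * int (Suc l) = 2 * n" "int (Suc K) - A - int (Suc l) = m"
      "2 * int K - 2 * int l = 2 * n" "int K - A - int l = m" "int K - (A + 1) - int l = m - 1"
      "int K - (A - 1) - int l = m + 1" "int K + 1 + A = int l + (2 * n + 1 - m)"
      "int K + 1 - A = int l + (m + 1)"
      by (simp_all add: n_def m_def)
    have e: "q powi (int l + i) = q ^ l * q powi i" for i
      using q_nonzero[OF q] by (simp add: power_int_add)
    have s: "(- q) ^ l = q ^ l * (- 1) ^ l"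
      using power_mult_distrib[of q "- 1 :: 'a fls" l] by simp
    show "?b l * (?f l + (q\<^sup>2) ^ (K - l) * ?f (Suc l)) =
      (- q) ^ l * ?b l * qbinom q (2 * int K - 2 * int l) (int K - A - int l)
      + q powi (int K + 1 + A) * ((- 1) ^ l * ?b l
          * qbinom q (2 * int K - 2 * int l) (int K - (A + 1) - int l))
      + q powi (int K + 1 - A) * ((- 1) ^ l * ?b l
          * qbinom q (2 * int K - 2 * int l) (int K - (A - 1) - int l))"
      unfolding Q a e power_Suc s qbinom_double_step1[OF n0] by (simp add: algebra_simps)
  qed
  finally show ?thesis
    unfolding T0_def T1_def by (simp add: sum.distrib sum_distrib_left)
qed

text \<open>
  After the upper indices have been lowered, the recurrence for \<open>T1\<close> holds term by term. The one
  for \<open>T0\<close> does not: the terms differ by an expression whose sum vanishes by \<open>sum_qbinom_shift\<close>.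
\<close>

lemma T0_rec:
  "T0 (Suc K) A q = T0 K (A - 1) q + q powi (int K + 1 + A) * T1 K A q
    + q powi (2 * (int K + 1 + A)) * T0 K (A + 1) q"
proof -
  let ?b = "\<lambda>l. qbinom (q\<^sup>2) (int K) (int l)"
  let ?f = "\<lambda>l. (- 1) ^ l * qbinom q (2 * int (Suc K) - 2 * int l) (int (Suc K) - A - int l)"
  define g where "g = (\<lambda>l. (- 1) ^ l * q powi (int K + 1 + A - int l)
    * qbinom q (2 * int K - 2 * int l + 1) (int K - A - int l))"
  let ?t = "\<lambda>l. (- 1) ^ l * ?b l * qbinom q (2 * int K - 2 * int l) (int K - (A - 1) - int l)
      + q powi (int K + 1 + A) * ((- q) ^ l * ?b l
          * qbinom q (2 * int K - 2 * int l) (int K - A - int l))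
      + q powi (2 * (int K + 1 + A)) * ((- 1) ^ l * ?b l
          * qbinom q (2 * int K - 2 * int l) (int K - (A + 1) - int l))"
  note q2 = fls_subdegree_power2_pos[OF q]
  have "T0 (Suc K) A q = (\<Sum>l = 0..Suc K. qbinom (q\<^sup>2) (int (Suc K)) (int l) * ?f l)"
    unfolding T0_def by (simp only: mult_ac)
  also have "\<dots> = (\<Sum>l = 0..K. ?b l * (?f l + (q\<^sup>2) ^ (K - l) * ?f (Suc l)))"
    by (rule sum_qbinom_Suc[OF q2])
  also have "\<dots> = (\<Sum>l = 0..K. ?t l + ?b l * ((1 - (q\<^sup>2) ^ l) * g l)
      - ?b l * ((1 - (q\<^sup>2) ^ (K - l)) * g (Suc l)))"
  proof (intro sum.cong refl)
    fix l assume l: "l \<in> {0..K}"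
    define n m where "n = int K - int l" and "m = int K - A - int l"
    have n0: "n \<ge> 0" using l by (simp add: n_def)
    have nn: "2 * n = int (2 * (K - l))" using l by (simp add: n_def)
    have Q: "(q\<^sup>2) ^ (K - l) = q powi (2 * n)"
      unfolding nn power_int_of_nat by (simp add: power_mult)
    have a: "2 * int (Suc K) - 2 * int l = 2 * n + 2" "int (Suc K) - A - int l = m + 1"
      "2 * int (Suc K) - 2 * int (Suc l) = 2 * n" "int (Suc K) - A - int (Suc l) = m"
      "2 * int K - 2 * int l = 2 * n" "int K - A - int l = m" "int K - (A + 1) - int l = m - 1"
      "int K - (A - 1) - int l = m + 1" "int K + 1 + A = int l + (2 * n + 1 - m)"
      by (simp_all add: n_def m_def)
    \<comment> \<open>the polynomial identity that remains once all powers and coefficients are named\<close>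
    have poly: "b * (e * (B + x * C + y * x * (C + y * x * D)) + x * z * (- 1 * e * C)) =
        e * b * B + u * (y * x) * (u * e * b * C) + u * (y * x) * (u * (y * x)) * (e * b * D) +
        b * ((1 - u * u) * (e * (y * x) * (C + y * x * D))) - b * - (e * x * ((1 - z) * C))"
      for b e B x C y D z u :: "'a fls"
      by (simp add: ring_distribs mult_ac)
    define x where "x = q powi (2 * n - m)"
    have x1: "q powi (2 * n + 1 - m) = q * x"
      using q_nonzero[OF q] power_int_add_1'[of q "2 * n - m"] by (simp add: x_def algebra_simps)
    have x2: "q powi (2 * n) = x * q powi m"
      using q_nonzero[OF q] by (simp add: x_def flip: power_int_add)
    have e1: "q powi (int l + (2 * n + 1 - m)) = q ^ l * (q * x)"
      using q_nonzero[OF q] by (simp add: power_int_add flip: x1)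
    have e2: "q powi (2 * (int l + (2 * n + 1 - m))) = (q ^ l * (q * x))\<^sup>2"
      unfolding e1[symmetric] mult_2 power2_eq_square
      using q_nonzero[OF q] by (intro power_int_add) simp
    have g1: "g l = (- 1) ^ l * (q * x) * qbinom q (2 * n + 1) m"
      using a(5,6) x1 by (simp add: g_def n_def m_def algebra_simps)
    have g2: "(1 - q powi (2 * n)) * g (Suc l) = - ((- 1) ^ l * x * ((1 - q powi m) * qbinom q (2 * n) m))"
    proof (cases "n = 0")
      case True
      then have "(1 - q powi m) * qbinom q (2 * n) m = 0"
        using qbinom_eq_0[OF q, of 0 m] by (cases "m = 0") (auto simp: neq_iff)
      with True show ?thesis by simp
    next
      case False
      then have "(1 - q powi m) * qbinom q (2 * n) m
          = (1 - q powi (2 * n)) * qbinom q (2 * n - 1) (m - 1)"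
        using qbinom_absorb[OF q, of "2 * n - 1" m] n0 by simp
      moreover have "g (Suc l) = - ((- 1) ^ l * x * qbinom q (2 * n - 1) (m - 1))"
        by (simp add: g_def n_def m_def x_def algebra_simps)
      ultimately show ?thesis
        by (simp only: mult_minus_right mult_ac)
    qed
    have d: "qbinom q (2 * n + 1) m = qbinom q (2 * n) m + q * x * qbinom q (2 * n) (m - 1)"
      using qbinom_pascal1[OF q, of "2 * n" m] n0 unfolding x1 by simp
    have s: "(- q) ^ l = q ^ l * (- 1) ^ l"
      using power_mult_distrib[of q "- 1 :: 'a fls" l] by simp
    have s2: "(q\<^sup>2) ^ l = q ^ l * q ^ l"
      by (simp add: power2_eq_square power_mult_distrib)
    show "?b l * (?f l + (q\<^sup>2) ^ (K - l) * ?f (Suc l)) =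
      ?t l + ?b l * ((1 - (q\<^sup>2) ^ l) * g l) - ?b l * ((1 - (q\<^sup>2) ^ (K - l)) * g (Suc l))"
      unfolding Q g2 g1 unfolding a e1 e2 qbinom_double_step2[OF n0] x1 d x2 s s2 power_Suc
      unfolding x_def[symmetric] power2_eq_square by (rule poly)
  qed
  also have "\<dots> = (\<Sum>l = 0..K. ?t l)"
    using sum_qbinom_shift[OF q2, of K g] by (simp add: sum.distrib sum_subtractf)
  finally show ?thesis
    unfolding T0_def T1_def by (simp add: sum.distrib sum_distrib_left)
qed

lemma T0_rec':
  "T0 (Suc K) A q = T0 K (A + 1) q + q powi (int K + 1 - A) * T1 K A q
    + q powi (2 * (int K + 1 - A)) * T0 K (A - 1) q"
  using T0_rec[of K "- A"] T0_sym[of K "A + 1"] T0_sym[of K "A - 1"] T1_sym[of K A] T0_sym[of "Suc K" A]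
  by simp

lemma qbinom_0_0: "qbinom q 0 0 = 1"
  using qbinom_eq[OF q, of 0 0] by simp

lemma T0_0: "T0 0 A q = of_bool (A = 0)"
  using qbinom_eq_0[OF q, of 0 "- A"] qbinom_eq[OF fls_subdegree_power2_pos[OF q], of 0 0] qbinom_0_0
  by (cases "A = 0") (auto simp: T0_def neq_iff)

lemma T1_0: "T1 0 A q = of_bool (A = 0)"
  using T0_0[of A] by (simp add: T0_def T1_def)

end


section \<open>Strict partitions\<close>

lemma strict_partition_Nil [simp]: "strict_partition []"
  by (simp add: strict_partition_def partition_def)

lemma lrg_Nil [simp]: "lrg [] = 0"
  by (simp add: lrg_def)

lemma lrg_Cons [simp]: "lrg (k # p) = max k (lrg p)"
proof -
  have "Max (insert k (insert 0 (set p))) = max k (lrg p)"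
    unfolding lrg_def by (subst Max_insert) auto
  then show ?thesis
    by (simp add: lrg_def insert_commute)
qed

lemma lrg_le_iff: "lrg p \<le> n \<longleftrightarrow> (\<forall>x\<in>set p. x \<le> n)"
  by (auto simp: lrg_def)

lemma lrg_less_iff: "lrg p < k \<longleftrightarrow> 0 < k \<and> (\<forall>x\<in>set p. x < k)"
  by (auto simp: lrg_def)

lemma strict_partition_Cons [simp]:
  "strict_partition (k # p) \<longleftrightarrow> lrg p < k \<and> strict_partition p"
proof -
  have *: "(\<forall>x\<in>set p. x \<le> k) \<and> k \<notin> set p \<longleftrightarrow> (\<forall>x\<in>set p. x < k)"
    using order.order_iff_strict by blast
  have "strict_partition (k # p) \<longleftrightarrow>
      0 < k \<and> ((\<forall>x\<in>set p. x \<le> k) \<and> k \<notin> set p) \<and> strict_partition p"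
    unfolding strict_partition_def partition_def by auto
  then show ?thesis
    unfolding * lrg_less_iff by blast
qed

lemma strict_partition_lrg_0: "strict_partition p \<Longrightarrow> lrg p = 0 \<longleftrightarrow> p = []"
  by (cases p) auto

lemma strict_partition_lrg_le_Suc:
  "strict_partition p \<and> lrg p \<le> Suc N \<longleftrightarrow>
    strict_partition p \<and> lrg p \<le> N \<or> (\<exists>p'. p = Suc N # p' \<and> strict_partition p' \<and> lrg p' \<le> N)"
proof (cases p)
  case (Cons k p')
  then show ?thesis
    by (cases "k = Suc N") (auto simp: max_def)
qed auto

lemma finite_strict_partitions: "finite {p. strict_partition p \<and> lrg p \<le> N}"
proof (rule finite_subset)
  show "{p. strict_partition p \<and> lrg p \<le> N} \<subseteq> {p. set p \<subseteq> {..N} \<and> distinct p}"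
    by (auto simp: strict_partition_def lrg_le_iff)
qed (rule finite_subset_distinct, simp)

lemma young_diagram_eq_Sigma: "young_diagram p = (SIGMA i:{1..length p}. {1..p ! (i - 1)})"
  by (auto simp: young_diagram_def)

lemma omega_eq_sum: "omega p = (\<Sum>i<length p. \<Sum>j = 1..p ! i. (- 1) ^ (Suc i + j))"
proof -
  have fin: "finite (young_diagram p)"
    by (simp add: young_diagram_eq_Sigma)
  have "omega p = (\<Sum>b\<in>young_diagram p. of_bool (residue2 b = 0) - of_bool (residue2 b = 1))"
    using fin by (simp add: omega_def sum_subtractf Int_def)
  also have "\<dots> = (\<Sum>b\<in>young_diagram p. (- 1) ^ (fst b + snd b))"
  proof (intro sum.cong refl)
    fix b
    have "residue2 b = of_bool (odd (fst b + snd b))"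
      unfolding residue2_def by (simp add: mod2_eq_if)
    then show "of_bool (residue2 b = 0) - of_bool (residue2 b = 1) = ((- 1) ^ (fst b + snd b) :: int)"
      by simp
  qed
  also have "\<dots> = (\<Sum>i = 1..length p. \<Sum>j = 1..p ! (i - 1). (- 1) ^ (i + j))"
    unfolding young_diagram_eq_Sigma by (subst sum.Sigma) (auto simp: split_beta)
  also have "\<dots> = (\<Sum>i<length p. \<Sum>j = 1..p ! i. (- 1) ^ (Suc i + j))"
    using sum.atLeast1_atMost_eq[of "\<lambda>i. \<Sum>j = 1..p ! (i - 1). (- 1) ^ (i + j) :: int" "length p"]
    by simp
  finally show ?thesis .
qed

lemma omega_Nil [simp]: "omega [] = 0"
  by (simp add: omega_eq_sum)

text \<open>
  A row contributes \<open>\<plusminus>1\<close> or \<open>0\<close> according to the parity of its length, and all residues below a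
  new first row are switched.
\<close>

lemma omega_Cons [simp]: "omega (k # p) = of_bool (odd k) - omega p"
proof -
  have "(\<Sum>j = 1..k. (- 1) ^ Suc j :: int) = of_bool (odd k)"
    by (induction k) auto
  then have row: "(\<Sum>j = 1..k. (- 1) ^ (Suc 0 + j) :: int) = of_bool (odd k)"
    by simp
  have "omega (k # p) = (\<Sum>j = 1..k. (- 1) ^ (Suc 0 + j)) +
      (\<Sum>i<length p. \<Sum>j = 1..p ! i. (- 1) ^ (Suc (Suc i) + j))"
    by (simp only: omega_eq_sum length_Cons sum.lessThan_Suc_shift nth_Cons_0 nth_Cons_Suc)
  then show ?thesis
    unfolding row by (simp add: omega_eq_sum sum_negf)
qed

text \<open>
  The partition obtained by deleting the first column of the Young diagram: all parts are diminished
  by one, and zeros are dropped.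
\<close>

definition del_col :: "nat list \<Rightarrow> nat list" where
  "del_col p = filter (\<lambda>x. x > 0) (map (\<lambda>x. x - 1) p)"

text \<open>
  The partition obtained by inserting a new first column, whose height is the number of parts, or
  one more if \<open>b\<close> holds.
\<close>

definition add_col :: "bool \<Rightarrow> nat list \<Rightarrow> nat list" where
  "add_col b p = map Suc p @ (if b then [1] else [])"

lemma del_col_Nil [simp]: "del_col [] = []"
  by (simp add: del_col_def)

lemma del_col_Cons [simp]:
  "del_col (k # p) = (if k \<le> 1 then del_col p else (k - 1) # del_col p)"
  by (auto simp: del_col_def)

lemma lrg_del_col [simp]: "lrg (del_col p) = lrg p - 1"
  by (induction p) (auto simp: max_def)

lemma strict_partition_del_col: "strict_partition p \<Longrightarrow> strict_partition (del_col p)"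
  by (induction p) auto

lemma length_del_col:
  "strict_partition p \<Longrightarrow> length (del_col p) + of_bool (1 \<in> set p) = length p"
proof (induction p)
  case (Cons k p)
  then show ?case
    by (cases "k = 1") (auto simp: strict_partition_lrg_0)
qed simp

lemma sum_list_del_col:
  "strict_partition p \<Longrightarrow> sum_list (del_col p) + length p = sum_list p"
  by (induction p) auto

lemma omega_del_col:
  "strict_partition p \<Longrightarrow> omega (del_col p) = of_bool (odd (length p)) - omega p"
proof (induction p)
  case (Cons k p)
  then show ?case
    by (cases "k = 1") (auto simp: strict_partition_lrg_0)
qed simp

lemma add_col_del_col: "strict_partition p \<Longrightarrow> add_col (1 \<in> set p) (del_col p) = p"
proof (induction p)
  case (Cons k p)
  then show ?case
    by (cases "k = 1") (auto simp: strict_partition_lrg_0 add_col_def)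
qed (simp add: add_col_def)

lemma del_col_add_col: "strict_partition p \<Longrightarrow> del_col (add_col b p) = p"
  by (induction p) (auto simp: add_col_def)

lemma length_add_col [simp]: "length (add_col b p) = length p + of_bool b"
  by (simp add: add_col_def)

lemma lrg_add_col_le: "lrg (add_col b p) \<le> Suc (lrg p)"
  by (induction p) (auto simp: add_col_def)

lemma strict_partition_add_col: "strict_partition p \<Longrightarrow> strict_partition (add_col b p)"
proof (induction p)
  case (Cons k p)
  then show ?case
    using lrg_add_col_le[of b p] by (simp add: add_col_def)
qed (simp add: add_col_def)


section \<open>Generating functions of Kleshchev bipartitions\<close>

text \<open>
  Bipartitions with \<open>lrg \<pi>\<^sup>1 \<le> len \<pi>\<^sup>2 + t\<close> and \<open>lrg \<pi>\<^sup>2 \<le> M\<close>, for every shift \<open>t\<close>. The Kleshchev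
  bipartitions are the cases \<open>t = 0\<close> and \<open>t = 1\<close>; \<open>t = 2\<close> is an auxiliary one. The
  residue difference generalises by the sign \<open>(-1)\<^sup>t\<close> in front of the second component.
\<close>

definition bipartitions :: "nat \<Rightarrow> nat \<Rightarrow> int \<Rightarrow> (nat list \<times> nat list) set" where
  "bipartitions t M s = {\<pi>. strict_partition (fst \<pi>) \<and> strict_partition (snd \<pi>) \<and>
     lrg (fst \<pi>) \<le> length (snd \<pi>) + t \<and> lrg (snd \<pi>) \<le> M \<and>
     omega (fst \<pi>) + (- 1) ^ t * omega (snd \<pi>) = s}"

text \<open>The generating function of these bipartitions by size, evaluated at \<open>x\<close>.\<close>

definition bigf :: "'a \<Rightarrow> nat \<Rightarrow> nat \<Rightarrow> int \<Rightarrow> 'a :: comm_semiring_1" where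
  "bigf x t M s = (\<Sum>\<pi>\<in>bipartitions t M s. x ^ bisize \<pi>)"

lemma finite_bipartitions: "finite (bipartitions t M s)"
proof (rule finite_subset)
  let ?S = "SIGMA p2:{p. strict_partition p \<and> lrg p \<le> M}.
    {p. strict_partition p \<and> lrg p \<le> length p2 + t}"
  show "bipartitions t M s \<subseteq> prod.swap ` ?S"
  proof
    fix \<pi> assume "\<pi> \<in> bipartitions t M s"
    then have "prod.swap \<pi> \<in> ?S"
      by (simp add: bipartitions_def prod.swap_def)
    then show "\<pi> \<in> prod.swap ` ?S"
      by (intro image_eqI[of _ _ "prod.swap \<pi>"]) simp_all
  qed
  show "finite (prod.swap ` ?S)"
    by (intro finite_imageI finite_SigmaI finite_strict_partitions)
qed

text \<open>The second summand collects the bipartitions whose second component has the part \<open>Suc M\<close>.\<close>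

lemma bigf_Suc:
  "bigf x t (Suc M) s =
    bigf x t M s + x ^ Suc M * bigf x (Suc t) M (s - (- 1) ^ t * of_bool (even M))"
proof -
  let ?h = "\<lambda>\<pi>. (fst \<pi>, Suc M # snd \<pi>)" and ?s = "s - (- 1) ^ t * of_bool (even M)"
  have "bipartitions t (Suc M) s = bipartitions t M s \<union> ?h ` bipartitions (Suc t) M ?s"
  proof (intro set_eqI)
    fix \<pi> :: "nat list \<times> nat list"
    obtain p1 p2 where [simp]: "\<pi> = (p1, p2)" by (cases \<pi>)
    have "\<pi> \<in> bipartitions t (Suc M) s \<longleftrightarrow> strict_partition p1 \<and> lrg p1 \<le> length p2 + t \<and>
        omega p1 + (- 1) ^ t * omega p2 = s \<and> (strict_partition p2 \<and> lrg p2 \<le> Suc M)"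
      by (auto simp: bipartitions_def)
    also have "\<dots> \<longleftrightarrow> \<pi> \<in> bipartitions t M s \<union> ?h ` bipartitions (Suc t) M ?s"
      unfolding strict_partition_lrg_le_Suc
      by (auto simp: bipartitions_def image_iff algebra_simps)
    finally show "\<pi> \<in> bipartitions t (Suc M) s \<longleftrightarrow>
      \<pi> \<in> bipartitions t M s \<union> ?h ` bipartitions (Suc t) M ?s" .
  qed
  moreover have "bipartitions t M s \<inter> ?h ` bipartitions (Suc t) M ?s = {}"
    by (auto simp: bipartitions_def)
  moreover have "inj_on ?h (bipartitions (Suc t) M ?s)"
    by (auto intro!: inj_onI simp: prod_eq_iff)
  ultimately show ?thesis
    by (simp add: bigf_def sum.union_disjoint finite_bipartitions sum.reindex sum_distrib_left
        bisize_def power_add mult_ac)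
qed

text \<open>
  The key bijection. If \<open>lrg \<pi>\<^sup>1\<close> is \<open>len \<pi>\<^sup>2 + 1\<close> or \<open>len \<pi>\<^sup>2 + 2\<close>, the largest part of \<open>\<pi>\<^sup>1\<close> is
  removed, diminished by one, and inserted into \<open>\<pi>\<^sup>2\<close> as a new first column. Conversely the first
  column of \<open>\<pi>\<^sup>2\<close>, enlarged by one box, becomes a first row of \<open>\<pi>\<^sup>1\<close>. The size changes by one, and
  since all residues are switched, the residue difference \<open>s\<close> becomes \<open>1 - s\<close>.
\<close>

lemma bigf_2: "bigf x 2 M s = bigf x 0 M s + x * bigf x 0 (Suc M) (1 - s)"
proof -
  let ?E = "{\<pi> \<in> bipartitions 2 M s. length (snd \<pi>) < lrg (fst \<pi>)}"
  have eq: "bipartitions 2 M s = bipartitions 0 M s \<union> ?E"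
    by (auto simp: bipartitions_def)
  have disj: "bipartitions 0 M s \<inter> ?E = {}"
    by (auto simp: bipartitions_def)
  have fin: "finite ?E"
    using finite_bipartitions[of 2 M s] by simp
  have "bigf x 2 M s = (\<Sum>\<pi>\<in>bipartitions 0 M s \<union> ?E. x ^ bisize \<pi>)"
    unfolding bigf_def by (rule sum.cong[OF eq refl])
  also have "\<dots> = bigf x 0 M s + (\<Sum>\<pi>\<in>?E. x ^ bisize \<pi>)"
    unfolding bigf_def by (rule sum.union_disjoint[OF finite_bipartitions fin disj])
  also have "(\<Sum>\<pi>\<in>?E. x ^ bisize \<pi>) = (\<Sum>\<pi>\<in>bipartitions 0 (Suc M) (1 - s). x * x ^ bisize \<pi>)"
  proof -
    \<comment> \<open>\<open>add_col\<close> receives a column of height \<open>lrg \<pi>\<^sup>1 - 1\<close>, which is \<open>len \<pi>\<^sup>2\<close> or \<open>len \<pi>\<^sup>2 + 1\<close>\<close>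
    define i where "i = (\<lambda>\<pi>. (Suc (length (snd \<pi>)) # fst \<pi>, del_col (snd \<pi>)))"
    define j where "j = (\<lambda>\<pi>. (tl (fst \<pi>), add_col (lrg (fst \<pi>) = length (snd \<pi>) + 2) (snd \<pi>)))"
    have E: "i (j \<pi>) = \<pi> \<and> j \<pi> \<in> bipartitions 0 (Suc M) (1 - s) \<and> bisize \<pi> = Suc (bisize (j \<pi>))"
      if E: "\<pi> \<in> ?E" for \<pi>
    proof -
      obtain m p1 p2 where \<pi>: "\<pi> = (m # p1, p2)"
        using E by (cases \<pi>; cases "fst \<pi>") auto
      define b p2' where "b \<longleftrightarrow> m = length p2 + 2" and "p2' = add_col b p2"
      from E \<pi> have st: "strict_partition p1" "strict_partition p2" "lrg p1 < m"
        and m: "m = length p2 + 1 \<or> m = length p2 + 2" and M: "lrg p2 \<le> M"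
        and s: "of_bool (odd m) - omega p1 + omega p2 = s"
        by (auto simp: bipartitions_def)
      have p2: "del_col p2' = p2" "strict_partition p2'" and len: "m = Suc (length p2')"
        and M': "lrg p2' \<le> Suc M"
        using st m M lrg_add_col_le[of b p2]
        by (auto simp: p2'_def del_col_add_col strict_partition_add_col b_def)
      have j: "j \<pi> = (p1, p2')"
        using st by (simp add: j_def \<pi> p2'_def b_def max_def)
      have "omega p1 + omega p2' = 1 - s"
        using s omega_del_col[OF p2(2)] by (auto simp: p2(1) len)
      moreover have "sum_list p2 + length p2' = sum_list p2'"
        using sum_list_del_col[OF p2(2)] by (simp add: p2(1))
      ultimately show ?thesis
        using st p2(2) len M' unfolding j
        by (simp add: i_def p2(1) \<pi> bipartitions_def bisize_def)
    qed
    have K: "j (i \<pi>) = \<pi> \<and> i \<pi> \<in> ?E" if K: "\<pi> \<in> bipartitions 0 (Suc M) (1 - s)" for \<pi>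
    proof -
      obtain p1 p2 where \<pi>: "\<pi> = (p1, p2)"
        by (cases \<pi>)
      from K \<pi> have st: "strict_partition p1" "strict_partition p2" and l: "lrg p1 \<le> length p2"
        and M: "lrg p2 \<le> Suc M" and s: "omega p1 + omega p2 = 1 - s"
        by (simp_all add: bipartitions_def)
      have i: "i \<pi> = (Suc (length p2) # p1, del_col p2)"
        by (simp add: i_def \<pi>)
      have len: "length (del_col p2) + of_bool (1 \<in> set p2) = length p2"
        using st by (simp only: length_del_col)
      have "max (Suc (length p2)) (lrg p1) = Suc (length p2)"
        using l by simp
      moreover have "Suc (length p2) = length (del_col p2) + 2 \<longleftrightarrow> 1 \<in> set p2"
        using len by (cases "1 \<in> set p2") (simp_all del: One_nat_def)
      ultimately have "j (i \<pi>) = \<pi>"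
        unfolding i j_def fst_conv snd_conv lrg_Cons using st by (simp only: add_col_del_col list.sel \<pi>)
      moreover have "of_bool (odd (Suc (length p2))) - omega p1 + omega (del_col p2) = s"
        using s omega_del_col[OF st(2)] by auto
      moreover have "length (del_col p2) < Suc (length p2)" "Suc (length p2) \<le> length (del_col p2) + 2"
        using len by (cases "1 \<in> set p2"; simp del: One_nat_def)+
      ultimately show ?thesis
        using st l M unfolding i
        by (simp add: bipartitions_def strict_partition_del_col max_def)
    qed
    show ?thesis
      using E K by (intro sum.reindex_bij_witness[of _ i j]) auto
  qed
  also have "\<dots> = x * bigf x 0 (Suc M) (1 - s)"
    by (simp add: bigf_def sum_distrib_left)
  finally show ?thesis .
qed

lemma bigf_0_0: "bigf x 0 0 s = of_bool (s = 0)"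
proof -
  have "bipartitions 0 0 s = (if s = 0 then {([], [])} else {})"
    by (auto simp: bipartitions_def strict_partition_lrg_0)
  then show ?thesis
    by (simp add: bigf_def bisize_def)
qed

lemma bigf_1_0: "bigf x 1 0 s = of_bool (s = 0) + x * of_bool (s = 1)"
proof -
  have *: "strict_partition p \<and> lrg p \<le> Suc 0 \<longleftrightarrow> p = [] \<or> p = [Suc 0]" for p
    unfolding strict_partition_lrg_le_Suc by (auto simp: strict_partition_lrg_0)
  have **: "\<pi> \<in> bipartitions 1 0 s \<longleftrightarrow>
      (strict_partition (fst \<pi>) \<and> lrg (fst \<pi>) \<le> Suc 0) \<and> snd \<pi> = [] \<and> omega (fst \<pi>) = s" for \<pi>
    by (auto simp: bipartitions_def strict_partition_lrg_0)
  have "bipartitions 1 0 s =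
      (if s = 0 then {([], [])} else if s = 1 then {([1], [])} else {})"
    unfolding set_eq_iff ** * by (auto simp: prod_eq_iff)
  then show ?thesis
    by (simp add: bigf_def bisize_def)
qed


section \<open>The closed forms\<close>

text \<open>
  In the induction step, \<open>T0_rec\<close> is used for even and its mirror image \<open>T0_rec'\<close> for odd \<open>Suc M\<close>;
  the extra \<open>T0\<close>-term in the second closed form is the contribution of the second summand in
  \<open>bigf_2\<close>.
\<close>

lemma bigf_closed_form:
  fixes q :: "'a :: field fls"
  assumes q: "fls_subdegree q > 0"
  shows "bigf q 0 N s = q powi (s * (s - 1)) * T0 N (s - of_bool (odd N)) q \<and>
    bigf q 1 N s = q powi (s\<^sup>2) *
      (T1 N s q + q powi (int N - (- 1) ^ N * s + 1) * T0 N (s - (- 1) ^ N) q)"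
proof (induction N arbitrary: s)
  case 0
  show ?case
    by (simp add: bigf_0_0 bigf_1_0 T0_0[OF q] T1_0[OF q] del: One_nat_def)
next
  case (Suc M)
  have pm: "q powi a * (q powi b * z) = q powi (a + b) * z" for a b z
    using q_nonzero[OF q] by (simp add: power_int_add)
  have p1: "q ^ Suc M = q powi (int M + 1)" and p2: "q ^ Suc M * q = q powi (int M + 2)"
    using power_int_of_nat[of q "Suc M"] power_int_of_nat[of q "Suc (Suc M)"]
    by (simp_all add: add.commute mult_ac)
  have rec0: "bigf q 0 (Suc M) s =
      bigf q 0 M s + q powi (int M + 1) * bigf q 1 M (s - of_bool (even M))" for s
    using bigf_Suc[of q 0 M s] unfolding p1 by simp
  have rec1: "bigf q 1 (Suc M) s = bigf q 1 M s
      + q powi (int M + 1) * bigf q 0 M (s + of_bool (even M))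
      + q powi (int M + 2) * bigf q 0 (Suc M) (1 - (s + of_bool (even M)))" for s
  proof -
    have "bigf q 1 (Suc M) s = bigf q 1 M s + q ^ Suc M * bigf q 2 M (s + of_bool (even M))"
      using bigf_Suc[of q 1 M s] by (simp add: numeral_2_eq_2)
    then show ?thesis
      unfolding bigf_2 distrib_left mult.assoc[symmetric] p2 unfolding p1 by (simp only: add.assoc)
  qed
  have IH0: "bigf q 0 M s = q powi (s * (s - 1)) * T0 M (s - of_bool (odd M)) q"
    and IH1: "bigf q 1 M s = q powi (s\<^sup>2) *
      (T1 M s q + q powi (int M - (- 1) ^ M * s + 1) * T0 M (s - (- 1) ^ M) q)" for s
    using Suc.IH[of s] by blast+
  show ?case
  proof (cases "even M")
    case True
    have A: "bigf q 0 (Suc M) s = q powi (s * (s - 1)) * T0 (Suc M) (s - 1) q" for s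
      using True T0_rec'[OF q, of M "s - 1"]
      by (simp add: rec0 IH0 IH1 distrib_left pm del: One_nat_def) (simp add: algebra_simps power2_eq_square)
    have "bigf q 1 (Suc M) s = q powi (s\<^sup>2) *
        (T1 (Suc M) s q + q powi (int M + s + 2) * T0 (Suc M) (s + 1) q)"
      using True T1_rec[OF q, of M s] T0_sym[OF q, of "Suc M" "s + 1"]
      by (simp add: rec1 A IH0 IH1 distrib_left pm del: One_nat_def) (simp add: algebra_simps power2_eq_square)
    with A[of s] True show ?thesis
      by (simp add: algebra_simps del: One_nat_def)
  next
    case False
    have A: "bigf q 0 (Suc M) s = q powi (s * (s - 1)) * T0 (Suc M) s q" for s
      using False T0_rec[OF q, of M s]
      by (simp add: rec0 IH0 IH1 distrib_left pm del: One_nat_def) (simp add: algebra_simps power2_eq_square)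
    have "bigf q 1 (Suc M) s = q powi (s\<^sup>2) *
        (T1 (Suc M) s q + q powi (int M - s + 2) * T0 (Suc M) (s - 1) q)"
      using False T1_rec[OF q, of M s] T0_sym[OF q, of "Suc M" "s - 1"]
      by (simp add: rec1 A IH0 IH1 distrib_left pm del: One_nat_def) (simp add: algebra_simps power2_eq_square)
    with A[of s] False show ?thesis
      by (simp add: algebra_simps del: One_nat_def)
  qed
qed

lemma bipartitions_kleshchev:
  "{\<pi> \<in> kleshchev 2. bilrg \<pi> \<le> N \<and> biomega 2 \<pi> = s} = bipartitions 0 N s"
  "{\<pi> \<in> kleshchev 1. bilrg \<pi> \<le> N \<and> biomega 1 \<pi> = s} = bipartitions 1 N s"
  by (auto simp: kleshchev_def bipartitions_def bilrg_def biomega_def tshift_def)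


theorem theorem1p3:
  fixes N :: nat and s :: int
  shows "(\<Sum>\<pi> | \<pi> \<in> kleshchev 2 \<and> bilrg \<pi> \<le> N \<and> biomega 2 \<pi> = s. (fls_X :: rat fls) ^ bisize \<pi>)
           = fls_X powi (s * (s - 1)) * T0 N (s - int N + 2 * int (N div 2)) fls_X
       \<and> (\<Sum>\<pi> | \<pi> \<in> kleshchev 1 \<and> bilrg \<pi> \<le> N \<and> biomega 1 \<pi> = s. (fls_X :: rat fls) ^ bisize \<pi>)
           = fls_X powi (s\<^sup>2) *
               (T1 N s fls_X
                 + fls_X powi (int N - (-1) ^ N * s + 1) * T0 N (s - (-1) ^ N) fls_X)"
proof -
  have e: "s - int N + 2 * int (N div 2) = s - of_bool (odd N)"
    by (cases "even N") (auto elim!: evenE oddE)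
  have "fls_subdegree (fls_X :: rat fls) > 0"
    by simp
  from bigf_closed_form[OF this, of N s] show ?thesis
    unfolding e bipartitions_kleshchev bigf_def .
qed

end
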